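(* Let $k\ge2$. For every $M\in\{1,2,\dots\}\cup\{\infty\}$ and every $N\in\{0,1,2,\dots\}$, the oriented spider-web graph $\vec{SW}_{k,N,M}$ is weakly isomorphic (isomorphic as oriented graphs, ignoring labels) to the oriented Schreier graph $\vec{\mathrm{Sch}}(\mathcal L_k,W_{N,M},X_k)$, where $W_{N,M}=\{g\in W_{N,1}:\exp_{X_k}(g)\equiv0\pmod M\}$.
   Context: Loops and multiple edges allowed. The oriented spider-web graph $\vec{SW}_{k,N,M}$ has vertex set $\{0,\dots,k-1\}^N\times\mathbb Z/M\mathbb Z$ (with $\mathbb Z/\infty\mathbb Z:=\mathbb Z$) and, for each vertex $(x_1\dots x_N,i)$ and each $y\in\{0,\dots,k-1\}$, one edge from $(x_1\dots x_N,i)$ to $(x_2\dots x_Ny,i+1)$. $\mathcal L_k=(\mathbb Z/k\mathbb Z)\wr\mathbb Z$ with $b$ the generator of $\mathbb Z$ (acting by shift), $c$ the generator of the copy of $\mathbb Z/k\mathbb Z$ at coordinate 0, $\bar c_r=c^rb$, $X_k=\{\bar c_0,\dots,\bar c_{k-1}\}$. $\mathcal L_k$ acts on words over $\{0,\dots,k-1\}$ by $\bar c_r.(x_1x_2\dots)=((x_1+r)(x_2+x_1)(x_3+x_2)\dots)$ mod $k$; $W_{N,1}$ is the stabilizer of the word $0^N$ (of length $N$). $\exp_{X_k}\colon\mathcal L_k\to\mathbb Z$ is the homomorphism sending every $\bar c_r$ to $1$ (the total exponent of a word in $X_k^{\pm1}$); "$\equiv0\pmod\infty$" means "$=0$". For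 $H\le G$ and generating set $S$, the oriented Schreier graph $\vec{\mathrm{Sch}}(G,H,S)$ has vertex set the right cosets $Hg$ and an edge labeled $s$ from $Hg$ to $Hgs$ for each $s\in S$. *)

theory Defs
  imports
    "HOL-Algebra.Algebra"
    "HOL-Number_Theory.Cong"
    "HOL-Library.Extended_Nat"
    "HOL-Computational_Algebra.Formal_Power_Series"
    "Graph_Theory.Digraph_Isomorphism"
begin

section \<open>Lamplighter groups\<close>

text \<open>
  The restricted wreath product of a group with the integers. The integer \<open>m\<close> acts on a
  finitely supported family by moving the entry at coordinate \<open>i\<close> to coordinate \<open>i + m\<close>.
\<close>

definition wreath_int :: "('a, 'm) monoid_scheme \<Rightarrow> ((int \<Rightarrow> 'a) \<times> int) monoid" where
  "wreath_int A =
    \<lparr>carrier = carrier (sum_group UNIV (\<lambda>_::int. A)) \<times> UNIV,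
     monoid.mult = (\<lambda>(f, m) (g, n).
       (f \<otimes>\<^bsub>sum_group UNIV (\<lambda>_::int. A)\<^esub> (\<lambda>i. g (i - m)), m + n)),
     one = (\<one>\<^bsub>sum_group UNIV (\<lambda>_::int. A)\<^esub>, 0)\<rparr>"

definition lamplighter :: "nat \<Rightarrow> ((int \<Rightarrow> int) \<times> int) monoid" where
  "lamplighter k = wreath_int (integer_mod_group k)"

definition lamp_b :: "nat \<Rightarrow> (int \<Rightarrow> int) \<times> int" where
  "lamp_b k = (\<one>\<^bsub>sum_group UNIV (\<lambda>_::int. integer_mod_group k)\<^esub>, 1)"

definition lamp_c :: "nat \<Rightarrow> (int \<Rightarrow> int) \<times> int" where
  "lamp_c k = ((\<lambda>i. if i = 0 then 1 else 0), 0)"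

definition lamp_cbar :: "nat \<Rightarrow> nat \<Rightarrow> (int \<Rightarrow> int) \<times> int" where
  "lamp_cbar k r = lamp_c k [^]\<^bsub>lamplighter k\<^esub> r \<otimes>\<^bsub>lamplighter k\<^esub> lamp_b k"

definition lamp_X :: "nat \<Rightarrow> ((int \<Rightarrow> int) \<times> int) set" where
  "lamp_X k = lamp_cbar k ` {..<k}"

text \<open>
  \<open>word_step k r (x\<^sub>1 x\<^sub>2 x\<^sub>3 \<dots>) = (x\<^sub>1 + r) (x\<^sub>2 + x\<^sub>1) (x\<^sub>3 + x\<^sub>2) \<dots>\<close> modulo \<open>k\<close>; the last letter
  of \<open>r # xs\<close> is dropped by \<^const>\<open>zip\<close>.
\<close>

definition word_step :: "nat \<Rightarrow> nat \<Rightarrow> nat list \<Rightarrow> nat list" where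
  "word_step k r xs = map2 (\<lambda>x p. (x + p) mod k) xs (r # xs)"

text \<open>
  The action of the lamplighter group on the finite words over \<open>{0, \<dots>, k - 1}\<close> and the total
  exponent are prescribed on the generators. That these prescriptions determine exactly one
  (left) action and exactly one homomorphism is proved below in \<open>ex1_lamp_action\<close> and
  \<open>ex1_lamp_exp\<close>.
\<close>

definition lamp_action :: "nat \<Rightarrow> (int \<Rightarrow> int) \<times> int \<Rightarrow> nat list \<Rightarrow> nat list" where
  "lamp_action k = (THE \<phi>. \<phi> \<in> extensional (carrier (lamplighter k)) \<and>
     group_action (lamplighter k) (lists {..<k}) \<phi> \<and>
     (\<forall>r<k. \<forall>w\<in>lists {..<k}. \<phi> (lamp_cbar k r) w = word_step k r w))"

definition lamp_exp :: "nat \<Rightarrow> (int \<Rightarrow> int) \<times> int \<Rightarrow> int" where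
  "lamp_exp k = (THE e. e \<in> extensional (carrier (lamplighter k)) \<and>
     e \<in> hom (lamplighter k) integer_group \<and> (\<forall>r<k. e (lamp_cbar k r) = 1))"

definition zero_mod :: "enat \<Rightarrow> int \<Rightarrow> bool" where
  "zero_mod M a = (case M of enat m \<Rightarrow> [a = 0] (mod int m) | \<infinity> \<Rightarrow> a = 0)"

definition lamp_W1 :: "nat \<Rightarrow> nat \<Rightarrow> ((int \<Rightarrow> int) \<times> int) set" where
  "lamp_W1 k N = stabilizer (lamplighter k) (lamp_action k) (replicate N 0)"

definition lamp_W :: "nat \<Rightarrow> nat \<Rightarrow> enat \<Rightarrow> ((int \<Rightarrow> int) \<times> int) set" where
  "lamp_W k N M = {g \<in> lamp_W1 k N. zero_mod M (lamp_exp k g)}"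


section \<open>Oriented Schreier graphs and spider-web graphs\<close>

text \<open>
  Oriented graphs are \<^typ>\<open>('a, 'b) pre_digraph\<close> records, which may be infinite and may have
  loops and multiple edges. The label of an edge is kept as part of its name only, so
  \<^const>\<open>digraph_iso\<close> is isomorphism of unlabelled oriented graphs.
\<close>

definition schreier_graph ::
    "('a, 'm) monoid_scheme \<Rightarrow> 'a set \<Rightarrow> 'a set \<Rightarrow> ('a set, 'a set \<times> 'a) pre_digraph" where
  "schreier_graph G H S =
    \<lparr>verts = rcosets\<^bsub>G\<^esub> H,
     arcs = (rcosets\<^bsub>G\<^esub> H) \<times> S,
     tail = fst,
     head = (\<lambda>(C, s). C #>\<^bsub>G\<^esub> s)\<rparr>"

definition cyclic_group :: "enat \<Rightarrow> int monoid" where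
  "cyclic_group M = (case M of enat m \<Rightarrow> integer_mod_group m | \<infinity> \<Rightarrow> integer_group)"

text \<open>
  The list \<^term>\<open>tl (xs @ [y])\<close> is \<open>x\<^sub>2 \<dots> x\<^sub>N y\<close>, and it is the empty word when \<open>N = 0\<close>. The
  step \<open>i + 1\<close> is the sum in \<open>\<int>/M\<int>\<close> with the class of \<open>1\<close>, which is represented by \<open>0\<close>
  when \<open>M = 1\<close>.
\<close>

definition spider_web ::
    "nat \<Rightarrow> nat \<Rightarrow> enat \<Rightarrow> (nat list \<times> int, (nat list \<times> int) \<times> nat) pre_digraph" where
  "spider_web k N M =
    (let V = {xs. set xs \<subseteq> {..<k} \<and> length xs = N} \<times> carrier (cyclic_group M) in
     \<lparr>verts = V,
      arcs = V \<times> {..<k},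
      tail = fst,
      head = (\<lambda>((xs, i), y). (tl (xs @ [y]), i \<otimes>\<^bsub>cyclic_group M\<^esub> 1))\<rparr>)"


section \<open>The group is generated by the \<open>lamp_cbar\<close>\<close>

lemma carrier_lamplighter:
  "carrier (lamplighter k) =
    {f. (\<forall>i. f i \<in> carrier (integer_mod_group k)) \<and> finite {i. f i \<noteq> 0}} \<times> UNIV"
  unfolding lamplighter_def wreath_int_def
  by (auto simp: carrier_sum_group)

lemma mult_lamplighter:
  "(f, m) \<otimes>\<^bsub>lamplighter k\<^esub> (g, n) = ((\<lambda>i. (f i + g (i - m)) mod int k), m + n)"
  unfolding lamplighter_def wreath_int_def by (simp add: fun_eq_iff)

lemma one_lamplighter: "\<one>\<^bsub>lamplighter k\<^esub> = ((\<lambda>_. 0), 0)"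
  unfolding lamplighter_def wreath_int_def by (simp add: fun_eq_iff)

lemma group_lamplighter:
  assumes "k > 0"
  shows "group (lamplighter k)"
proof (rule groupI)
  fix x y assume "x \<in> carrier (lamplighter k)" "y \<in> carrier (lamplighter k)"
  moreover obtain f m g n where [simp]: "x = (f, m)" "y = (g, n)" by force
  ultimately have f: "finite {i. f i \<noteq> 0}" and g: "finite {i. g i \<noteq> 0}"
    by (auto simp: carrier_lamplighter)
  have "{i. (f i + g (i - m)) mod int k \<noteq> 0} \<subseteq> {i. f i \<noteq> 0} \<union> (\<lambda>i. i + m) ` {i. g i \<noteq> 0}"
    by (auto simp: image_iff) (metis add.commute diff_add_cancel mod_0 add_0)
  then have "finite {i. (f i + g (i - m)) mod int k \<noteq> 0}"
    using f g by (meson finite_UnI finite_imageI finite_subset)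
  then show "x \<otimes>\<^bsub>lamplighter k\<^esub> y \<in> carrier (lamplighter k)"
    using assms by (auto simp: carrier_lamplighter mult_lamplighter carrier_integer_mod_group)
next
  fix x assume "x \<in> carrier (lamplighter k)"
  moreover obtain f m where x: "x = (f, m)" by force
  ultimately have f: "\<And>i. 0 \<le> f i \<and> f i < int k" "finite {i. f i \<noteq> 0}"
    using assms by (auto simp: carrier_lamplighter carrier_integer_mod_group)
  show "\<one>\<^bsub>lamplighter k\<^esub> \<otimes>\<^bsub>lamplighter k\<^esub> x = x"
    using f by (simp add: x one_lamplighter mult_lamplighter)
  have "{i. (- f (i + m)) mod int k \<noteq> 0} \<subseteq> (\<lambda>i. i - m) ` {i. f i \<noteq> 0}"
    by (auto simp: image_iff) (metis add_diff_cancel_right' minus_zero mod_0)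
  then have "finite {i. (- f (i + m)) mod int k \<noteq> 0}"
    using f(2) by (meson finite_imageI finite_subset)
  then have "((\<lambda>i. (- f (i + m)) mod int k), - m) \<in> carrier (lamplighter k)"
    using assms by (auto simp: carrier_lamplighter carrier_integer_mod_group)
  moreover have "((\<lambda>i. (- f (i + m)) mod int k), - m) \<otimes>\<^bsub>lamplighter k\<^esub> x = \<one>\<^bsub>lamplighter k\<^esub>"
    by (simp add: x one_lamplighter mult_lamplighter mod_add_left_eq)
  ultimately show "\<exists>y\<in>carrier (lamplighter k). y \<otimes>\<^bsub>lamplighter k\<^esub> x = \<one>\<^bsub>lamplighter k\<^esub>"
    by blast
qed (use assms in \<open>auto simp: carrier_lamplighter mult_lamplighter one_lamplighter
      carrier_integer_mod_group mod_add_left_eq mod_add_right_eq algebra_simps\<close>)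

lemma lamp_cbar_eq:
  assumes "k \<ge> 2"
  shows "lamp_cbar k r = ((\<lambda>i. if i = 0 then int r mod int k else 0), 1)"
proof -
  interpret group "lamplighter k" using assms by (intro group_lamplighter) auto
  have "lamp_c k [^]\<^bsub>lamplighter k\<^esub> r = ((\<lambda>i. if i = 0 then int r mod int k else 0), 0)"
  proof (induction r)
    case 0
    show ?case by (auto simp: one_lamplighter)
  next
    case (Suc r)
    then show ?case
      using assms by (auto simp: lamp_c_def mult_lamplighter mod_add_left_eq mod_add_right_eq fun_eq_iff add.commute)
  qed
  then show ?thesis
    by (auto simp: lamp_cbar_def lamp_b_def mult_lamplighter fun_eq_iff)
qed

lemma lamp_X_carrier:
  assumes "k \<ge> 2"
  shows "lamp_X k \<subseteq> carrier (lamplighter k)"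
  using assms
  by (auto simp: lamp_X_def lamp_cbar_eq carrier_lamplighter carrier_integer_mod_group)

lemma generate_lamp_X:
  assumes k: "k \<ge> 2"
  shows "generate (lamplighter k) (lamp_X k) = carrier (lamplighter k)"
proof -
  let ?L = "lamplighter k"
  interpret group ?L using k by (intro group_lamplighter) auto
  define H where "H = generate ?L (lamp_X k)"
  have sub: "subgroup H ?L"
    unfolding H_def by (rule generate_is_subgroup[OF lamp_X_carrier[OF k]])
  have cbar: "lamp_cbar k r \<in> H" if "r < k" for r
    using that by (auto simp: H_def lamp_X_def intro: generate.incl)
  have mult: "x \<otimes>\<^bsub>?L\<^esub> y \<in> H" if "x \<in> H" "y \<in> H" for x y
    using that sub by (rule subgroup.m_closed[rotated 1])
  have inv_b: "inv\<^bsub>?L\<^esub> ((\<lambda>_. 0), n) = ((\<lambda>_. 0), - n)" for n :: int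
    by (rule inv_equality)
      (auto simp: mult_lamplighter one_lamplighter carrier_lamplighter)
  have b: "((\<lambda>_. 0), 1) \<in> H"
    using cbar[of 0] k by (simp add: lamp_cbar_eq cong: if_cong)
  have pos: "((\<lambda>_. 0), int n) \<in> H" for n
  proof (induction n)
    case 0
    show ?case using subgroup.one_closed[OF sub] by (simp add: one_lamplighter)
  next
    case (Suc n)
    then show ?case using mult[OF b Suc] by (simp add: mult_lamplighter)
  qed
  have shift: "((\<lambda>_. 0), n) \<in> H" for n :: int
  proof (cases n)
    case (nonneg m)
    then show ?thesis using pos by simp
  next
    case (neg m)
    then show ?thesis
      using subgroup.m_inv_closed[OF sub pos[of "Suc m"]] by (simp add: inv_b)
  qed
  have single: "((\<lambda>i. if i = j then a else 0), 0) \<in> H" if "0 \<le> a" "a < int k" for j a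
  proof -
    have "lamp_cbar k (nat a) \<in> H" using that k by (intro cbar) auto
    from mult[OF mult[OF shift[of j] this] shift[of "- j - 1"]] that k
    have "((\<lambda>i. (if i = j then a else 0) mod int k), 0) \<in> H"
      by (simp add: lamp_cbar_eq mult_lamplighter cong: if_cong)
    also have "(\<lambda>i. (if i = j then a else 0) mod int k) = (\<lambda>i. if i = j then a else 0)"
      using that by (auto simp: fun_eq_iff)
    finally show ?thesis .
  qed
  have lamps: "(f, 0) \<in> H"
    if "finite S" "\<And>i. 0 \<le> f i \<and> f i < int k" "\<And>i. i \<notin> S \<Longrightarrow> f i = 0" for S f
    using that
  proof (induction S arbitrary: f rule: finite_induct)
    case empty
    then have "f = (\<lambda>_. 0)" by auto
    then show ?case using shift by simp
  next
    case (insert j S)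
    have "(f(j := 0), 0) \<in> H"
      using insert.prems k by (intro insert.IH) auto
    from mult[OF this single[of "f j" j]] insert.prems
    have "((\<lambda>i. ((f(j := 0)) i + (if i = j then f j else 0)) mod int k), 0) \<in> H"
      by (simp add: mult_lamplighter)
    also have "(\<lambda>i. ((f(j := 0)) i + (if i = j then f j else 0)) mod int k) = f"
      using insert.prems(1) by (auto simp: fun_eq_iff)
    finally show ?case .
  qed
  have "carrier ?L \<subseteq> H"
  proof
    fix x assume "x \<in> carrier ?L"
    moreover obtain f n where x: "x = (f, n)" by force
    ultimately have f: "\<And>i. 0 \<le> f i \<and> f i < int k" "finite {i. f i \<noteq> 0}"
      using k by (auto simp: carrier_lamplighter carrier_integer_mod_group)
    have "(f, 0) \<in> H" by (rule lamps[OF f(2) f(1)]) auto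
    from mult[OF this shift[of n]] f show "x \<in> H"
      by (simp add: x mult_lamplighter)
  qed
  then show ?thesis
    using subgroup.subset[OF sub] by (auto simp: H_def)
qed

lemma hom_eq_on_generate:
  fixes G :: "('a, 'm) monoid_scheme" and H :: "('b, 'n) monoid_scheme"
  assumes "group_hom G H f" "group_hom G H g" "S \<subseteq> carrier G" "\<And>x. x \<in> S \<Longrightarrow> f x = g x"
    and "x \<in> generate G S"
  shows "f x = g x"
proof -
  interpret f: group_hom G H f by fact
  interpret g: group_hom G H g by fact
  from assms(5) show ?thesis
  proof (induction rule: generate.induct)
    case (inv h)
    then show ?case using assms(3,4) by (metis f.hom_inv g.hom_inv subsetD)
  next
    case (eng h1 h2)
    then show ?case
      using f.G.generate_in_carrier[OF assms(3)] by simp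
  qed (use assms(4) in auto)
qed


section \<open>Existence and uniqueness of the total exponent\<close>

lemma ex1_lamp_exp_aux:
  assumes k: "k \<ge> 2"
    and e: "e \<in> extensional (carrier (lamplighter k))"
      "e \<in> hom (lamplighter k) integer_group" "\<forall>r<k. e (lamp_cbar k r) = 1"
  shows "e = restrict snd (carrier (lamplighter k))"
proof
  have L: "group (lamplighter k)" using k by (intro group_lamplighter) auto
  have s: "snd \<in> hom (lamplighter k) integer_group"
    by (rule homI) (auto simp: carrier_lamplighter mult_lamplighter)
  fix x show "e x = restrict snd (carrier (lamplighter k)) x"
  proof (cases "x \<in> carrier (lamplighter k)")
    case True
    have gh: "group_hom (lamplighter k) integer_group e"
      "group_hom (lamplighter k) integer_group snd"
      using L e(2) s by (auto simp: group_hom_def group_hom_axioms_def)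
    have "e x = snd x"
    proof (rule hom_eq_on_generate[OF gh lamp_X_carrier[OF k]])
      show "e y = snd y" if "y \<in> lamp_X k" for y
        using that e(3) k by (auto simp: lamp_X_def lamp_cbar_eq)
    qed (use generate_lamp_X[OF k] True in auto)
    then show ?thesis using True by simp
  next
    case False
    then show ?thesis using extensional_arb[OF e(1) False] by (simp only: restrict_apply if_False)
  qed
qed

lemma ex1_lamp_exp:
  assumes k: "k \<ge> 2"
  shows "\<exists>!e. e \<in> extensional (carrier (lamplighter k)) \<and>
     e \<in> hom (lamplighter k) integer_group \<and> (\<forall>r<k. e (lamp_cbar k r) = 1)"
proof (rule ex1I)
  interpret group "lamplighter k" using k by (intro group_lamplighter) auto
  let ?e = "restrict snd (carrier (lamplighter k))"
  have "?e (x \<otimes>\<^bsub>lamplighter k\<^esub> y) = ?e x + ?e y"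
    if "x \<in> carrier (lamplighter k)" "y \<in> carrier (lamplighter k)" for x y
    using m_closed[OF that] that by (cases x; cases y) (simp add: mult_lamplighter)
  then have "?e \<in> hom (lamplighter k) integer_group"
    by (intro homI) auto
  moreover have "?e (lamp_cbar k r) = 1" if "r < k" for r
    using lamp_X_carrier[OF k] that k by (auto simp: lamp_X_def lamp_cbar_eq)
  ultimately show "?e \<in> extensional (carrier (lamplighter k)) \<and>
     ?e \<in> hom (lamplighter k) integer_group \<and> (\<forall>r<k. ?e (lamp_cbar k r) = 1)"
    by auto
qed (use ex1_lamp_exp_aux[OF k] in blast)

lemma lamp_exp_eq:
  assumes "k \<ge> 2" "g \<in> carrier (lamplighter k)"
  shows "lamp_exp k g = snd g"
  using theI'[OF ex1_lamp_exp[OF assms(1)], folded lamp_exp_def]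
    ex1_lamp_exp_aux[OF assms(1), of "lamp_exp k"] assms(2) by auto


section \<open>Existence and uniqueness of the action\<close>

text \<open>
  Reading a word as the power series \<open>x\<^sub>1 + x\<^sub>2 X + x\<^sub>3 X\<^sup>2 + \<dots>\<close> modulo \<open>k\<close>, the generator \<open>c\<^sup>r b\<close>
  acts by \<open>w \<mapsto> (1 + X) w + r\<close>.
\<close>

definition xpow :: "int \<Rightarrow> int fps" where
  "xpow n = (if n \<ge> 0 then (1 + fps_X) ^ nat n else Abs_fps (\<lambda>i. (- 1) ^ i) ^ nat (- n))"

lemma xpow_0 [simp]: "xpow 0 = 1" and xpow_1 [simp]: "xpow 1 = 1 + fps_X"
  by (simp_all add: xpow_def)

lemma xpow_inverse: "(1 + fps_X) * Abs_fps (\<lambda>i. (- 1) ^ i) = (1 :: int fps)"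
proof (rule fps_ext)
  fix n show "fps_nth ((1 + fps_X) * Abs_fps (\<lambda>i. (- 1) ^ i)) n = fps_nth (1 :: int fps) n"
    by (cases n) (auto simp: distrib_right)
qed

lemma xpow_Suc: "xpow (n + 1) = (1 + fps_X) * xpow n"
proof (cases "n \<ge> 0")
  case True
  then show ?thesis by (simp add: xpow_def nat_add_distrib)
next
  case False
  define m where "m = nat (- n) - 1"
  have n: "n = - int (Suc m)" using False by (simp add: m_def)
  have "\<not> n \<ge> 0" "nat (- n) = Suc m" using False by (auto simp: m_def)
  have "xpow (n + 1) = Abs_fps (\<lambda>i. (- 1) ^ i) ^ m"
    by (cases m) (auto simp: n xpow_def nat_add_distrib)
  moreover have "xpow n = Abs_fps (\<lambda>i. (- 1) ^ i) * Abs_fps (\<lambda>i. (- 1) ^ i) ^ m"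
    using \<open>\<not> n \<ge> 0\<close> \<open>nat (- n) = Suc m\<close> by (simp add: xpow_def)
  ultimately show ?thesis
    by (simp add: mult.assoc[symmetric] xpow_inverse)
qed

lemma xpow_add: "xpow (m + n) = xpow m * xpow n"
proof (induction m rule: int_induct[where k = 0])
  case (step1 i)
  then show ?case using xpow_Suc[of "i + n"] xpow_Suc[of i] by (simp add: algebra_simps)
next
  case (step2 i)
  have "(1 + fps_X) * xpow (i - 1 + n) = (1 + fps_X) * (xpow (i - 1) * xpow n)"
    using step2 xpow_Suc[of "i - 1 + n"] xpow_Suc[of "i - 1"] by (simp add: algebra_simps)
  then have "Abs_fps (\<lambda>i. (- 1) ^ i) * ((1 + fps_X) * xpow (i - 1 + n)) =
    Abs_fps (\<lambda>i. (- 1) ^ i) * ((1 + fps_X) * (xpow (i - 1) * xpow n))" by simp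
  then show ?case
    using xpow_inverse
    by (simp only: mult.assoc[symmetric] mult.commute[of "Abs_fps _" "1 + fps_X"]) simp
qed simp

definition lamp_series :: "(int \<Rightarrow> int) \<Rightarrow> int fps" where
  "lamp_series f = (\<Sum>j | f j \<noteq> 0. fps_const (f j) * xpow j)"

definition word_series :: "nat list \<Rightarrow> int fps" where
  "word_series w = Abs_fps (\<lambda>i. if i < length w then int (w ! i) else 0)"

definition series_word :: "nat \<Rightarrow> nat \<Rightarrow> int fps \<Rightarrow> nat list" where
  "series_word k N s = map (\<lambda>i. nat (fps_nth s i mod int k)) [0..<N]"

definition series_cong :: "nat \<Rightarrow> nat \<Rightarrow> int fps \<Rightarrow> int fps \<Rightarrow> bool" where
  "series_cong k N s t = (\<forall>i<N. [fps_nth s i = fps_nth t i] (mod int k))"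

definition act :: "nat \<Rightarrow> (int \<Rightarrow> int) \<times> int \<Rightarrow> nat list \<Rightarrow> nat list" where
  "act k g w = series_word k (length w) (xpow (snd g) * word_series w + lamp_series (fst g))"

lemma lamp_series_superset:
  assumes "finite S" "{j. f j \<noteq> 0} \<subseteq> S"
  shows "lamp_series f = (\<Sum>j\<in>S. fps_const (f j) * xpow j)"
  unfolding lamp_series_def by (rule sum.mono_neutral_left) (use assms in auto)

lemma series_cong_refl [simp]: "series_cong k N s s"
  by (simp add: series_cong_def)

lemma series_cong_trans: "series_cong k N s t \<Longrightarrow> series_cong k N t u \<Longrightarrow> series_cong k N s u"
  by (auto simp: series_cong_def intro: cong_trans)

lemma series_cong_add:
  "series_cong k N s t \<Longrightarrow> series_cong k N s' t' \<Longrightarrow> series_cong k N (s + s') (t + t')"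
  by (auto simp: series_cong_def intro: cong_add)

lemma series_cong_mult:
  "series_cong k N s t \<Longrightarrow> series_cong k N (u * s) (u * t)"
  unfolding series_cong_def fps_mult_nth
  by (auto intro!: cong_sum cong_mult)

lemma series_word_cong:
  "series_cong k N s t \<Longrightarrow> series_word k N s = series_word k N t"
  by (auto simp: series_word_def series_cong_def cong_def)

lemma word_series_series_word:
  "k > 0 \<Longrightarrow> series_cong k N (word_series (series_word k N s)) s"
  by (auto simp: series_cong_def word_series_def series_word_def cong_def)

lemma lamp_series_mult:
  assumes "finite {j. f j \<noteq> 0}" "finite {j. g j \<noteq> 0}"
  shows "series_cong k N (lamp_series (\<lambda>i. (f i + g (i - m)) mod int k))
    (lamp_series f + xpow m * lamp_series g)"
proof -
  define S where "S = {j. f j \<noteq> 0} \<union> (\<lambda>j. j + m) ` {j. g j \<noteq> 0}"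
  have S: "finite S" using assms by (auto simp: S_def)
  have mem: "i \<in> S" if "g (i - m) \<noteq> 0" for i
    using that by (auto simp: S_def image_iff intro!: exI[of _ "i - m"])
  have 1: "lamp_series (\<lambda>i. (f i + g (i - m)) mod int k) =
      (\<Sum>j\<in>S. fps_const ((f j + g (j - m)) mod int k) * xpow j)"
  proof (rule lamp_series_superset[OF S], rule subsetI)
    fix j assume j: "j \<in> {j. (f j + g (j - m)) mod int k \<noteq> 0}"
    show "j \<in> S"
    proof (cases "g (j - m) = 0")
      case True
      then have "f j \<noteq> 0" using j by auto
      then show ?thesis by (simp add: S_def)
    qed (rule mem)
  qed
  have 2: "lamp_series f = (\<Sum>j\<in>S. fps_const (f j) * xpow j)"
    by (rule lamp_series_superset[OF S]) (auto simp: S_def)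
  have "lamp_series g = (\<Sum>j\<in>(\<lambda>j. j - m) ` S. fps_const (g j) * xpow j)"
  proof (rule lamp_series_superset, simp add: S, rule subsetI)
    fix j assume "j \<in> {j. g j \<noteq> 0}"
    then have "j + m \<in> S" using mem[of "j + m"] by simp
    then show "j \<in> (\<lambda>j. j - m) ` S" by (rule rev_image_eqI) simp
  qed
  also have "\<dots> = (\<Sum>j\<in>S. fps_const (g (j - m)) * xpow (j - m))"
    by (subst sum.reindex) (auto simp: inj_on_def)
  finally have g: "lamp_series g = (\<Sum>j\<in>S. fps_const (g (j - m)) * xpow (j - m))" .
  have "xpow m * (fps_const (g (j - m)) * xpow (j - m)) = fps_const (g (j - m)) * xpow j" for j
    using xpow_add[of m "j - m"] by (simp only: mult.left_commute[of "xpow m"]) simp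
  then have 3: "xpow m * lamp_series g = (\<Sum>j\<in>S. fps_const (g (j - m)) * xpow j)"
    by (simp only: g sum_distrib_left)
  show ?thesis
    unfolding 1 2 3 sum.distrib[symmetric]
    by (auto simp: series_cong_def fps_sum_nth distrib_right[symmetric] cong_def
        intro!: cong_sum[unfolded cong_def] mod_mult_left_eq)
qed

lemma series_word_in_lists: "k > 0 \<Longrightarrow> series_word k N s \<in> lists {..<k}"
  by (auto simp: series_word_def nat_less_iff)

lemma act_in_lists: "k > 0 \<Longrightarrow> act k g w \<in> lists {..<k}"
  unfolding act_def by (rule series_word_in_lists)

lemma length_act [simp]: "length (act k g w) = length w"
  by (simp add: act_def series_word_def)

lemma act_one: "w \<in> lists {..<k} \<Longrightarrow> act k \<one>\<^bsub>lamplighter k\<^esub> w = w"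
  by (auto simp: act_def one_lamplighter lamp_series_def series_word_def word_series_def
      in_lists_conv_set nth_mem intro!: nth_equalityI)

lemma act_mult:
  assumes k: "k > 0" and "x \<in> carrier (lamplighter k)" "y \<in> carrier (lamplighter k)"
  shows "act k (x \<otimes>\<^bsub>lamplighter k\<^esub> y) w = act k x (act k y w)"
proof -
  obtain f m g n where x: "x = (f, m)" and y: "y = (g, n)" by force
  have fin: "finite {j. f j \<noteq> 0}" "finite {j. g j \<noteq> 0}"
    using assms by (auto simp: x y carrier_lamplighter)
  let ?N = "length w"
  have "series_cong k ?N
    (xpow (m + n) * word_series w + lamp_series (\<lambda>i. (f i + g (i - m)) mod int k))
    (xpow (m + n) * word_series w + (lamp_series f + xpow m * lamp_series g))"
    by (intro series_cong_add series_cong_refl lamp_series_mult fin)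
  also have "xpow (m + n) * word_series w + (lamp_series f + xpow m * lamp_series g) =
    xpow m * (xpow n * word_series w + lamp_series g) + lamp_series f"
    by (simp add: xpow_add algebra_simps)
  finally have 1: "series_cong k ?N
    (xpow (m + n) * word_series w + lamp_series (\<lambda>i. (f i + g (i - m)) mod int k))
    (xpow m * (xpow n * word_series w + lamp_series g) + lamp_series f)" .
  have 2: "series_cong k ?N (xpow m * word_series (act k y w) + lamp_series f)
    (xpow m * (xpow n * word_series w + lamp_series g) + lamp_series f)"
    unfolding act_def y fst_conv snd_conv
    by (intro series_cong_add series_cong_mult series_cong_refl word_series_series_word k)
  have "act k (x \<otimes>\<^bsub>lamplighter k\<^esub> y) w = series_word k ?N
    (xpow (m + n) * word_series w + lamp_series (\<lambda>i. (f i + g (i - m)) mod int k))"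
    by (simp add: act_def x y mult_lamplighter)
  also have "\<dots> = series_word k ?N (xpow m * word_series (act k y w) + lamp_series f)"
    using series_word_cong[OF 1] series_word_cong[OF 2] by simp
  also have "\<dots> = act k x (act k y w)"
    by (simp add: act_def[of k "(f, m)"] x)
  finally show ?thesis .
qed

lemma act_lamp_cbar:
  assumes k: "k \<ge> 2" and r: "r < k"
  shows "act k (lamp_cbar k r) w = word_step k r w"
proof -
  have "lamp_series (\<lambda>i. if i = 0 then int r else 0) = fps_const (int r)"
    by (subst lamp_series_superset[of "{0}"]) auto
  moreover have "lamp_cbar k r = ((\<lambda>i. if i = 0 then int r else 0), 1)"
    using assms by (auto simp: lamp_cbar_eq fun_eq_iff)
  ultimately have "act k (lamp_cbar k r) w =
      series_word k (length w) ((1 + fps_X) * word_series w + fps_const (int r))"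
    by (simp add: act_def)
  also have "\<dots> = word_step k r w"
  proof (rule nth_equalityI)
    fix i assume "i < length (series_word k (length w)
      ((1 + fps_X) * word_series w + fps_const (int r)))"
    then have i: "i < length w" by (simp add: series_word_def)
    show "series_word k (length w) ((1 + fps_X) * word_series w + fps_const (int r)) ! i =
      word_step k r w ! i"
      using i by (cases i)
        (auto simp: series_word_def word_step_def word_series_def distrib_right
          of_nat_add[symmetric] zmod_int[symmetric] simp del: of_nat_add)
  qed (simp add: series_word_def word_step_def)
  finally show ?thesis .
qed

lemma group_action_act:
  assumes k: "k \<ge> 2"
  defines "L \<equiv> lamplighter k" and "E \<equiv> lists {..<k}"
  shows "group_action L E (\<lambda>g\<in>carrier L. \<lambda>w\<in>E. act k g w)"
proof -
  have k0: "k > 0" using k by simp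
  interpret group L unfolding L_def by (rule group_lamplighter[OF k0])
  have inv: "act k x (act k y w) = w"
    if "w \<in> E" "x \<in> carrier L" "y \<in> carrier L" "x \<otimes>\<^bsub>L\<^esub> y = \<one>\<^bsub>L\<^esub>" for x y w
    using that act_mult[OF k0, of x y w] act_one[of w k] by (simp add: L_def E_def)
  have bij: "(\<lambda>w\<in>E. act k g w) \<in> Bij E" if "g \<in> carrier L" for g
  proof -
    have "bij_betw (act k g) E E"
      by (rule bij_betw_byWitness[of _ "act k (inv\<^bsub>L\<^esub> g)"])
        (use that k0 in \<open>auto simp: inv intro!: act_in_lists[OF k0, folded E_def]\<close>)
    then show ?thesis
      by (simp add: Bij_def bij_betw_def inj_on_def)
  qed
  show ?thesis
    unfolding group_action_def group_hom_def group_hom_axioms_def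
  proof (intro conjI homI)
    show "group L" "group (BijGroup E)" by (simp_all add: is_group group_BijGroup)
  next
    fix x assume "x \<in> carrier L"
    then show "(\<lambda>g\<in>carrier L. \<lambda>w\<in>E. act k g w) x \<in> carrier (BijGroup E)"
      using bij by (simp add: BijGroup_def)
  next
    fix x y assume xy: "x \<in> carrier L" "y \<in> carrier L"
    have "(\<lambda>w\<in>E. act k (x \<otimes>\<^bsub>L\<^esub> y) w) = compose E (\<lambda>w\<in>E. act k x w) (\<lambda>w\<in>E. act k y w)"
      using xy k0 act_mult[OF k0, of x y] act_in_lists[OF k0, folded E_def]
      by (auto simp: compose_def fun_eq_iff L_def)
    then show "(\<lambda>g\<in>carrier L. \<lambda>w\<in>E. act k g w) (x \<otimes>\<^bsub>L\<^esub> y) =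
      (\<lambda>g\<in>carrier L. \<lambda>w\<in>E. act k g w) x \<otimes>\<^bsub>BijGroup E\<^esub> (\<lambda>g\<in>carrier L. \<lambda>w\<in>E. act k g w) y"
      using xy bij by (simp add: BijGroup_def)
  qed
qed

lemma ex1_lamp_action_aux:
  assumes k: "k \<ge> 2"
    and \<phi>: "\<phi> \<in> extensional (carrier (lamplighter k))"
      "group_action (lamplighter k) (lists {..<k}) \<phi>"
      "\<forall>r<k. \<forall>w\<in>lists {..<k}. \<phi> (lamp_cbar k r) w = word_step k r w"
  shows "\<phi> = (\<lambda>g\<in>carrier (lamplighter k). \<lambda>w\<in>lists {..<k}. act k g w)"
proof
  let ?L = "lamplighter k" and ?E = "lists {..<k}"
  let ?\<psi> = "\<lambda>g\<in>carrier ?L. \<lambda>w\<in>?E. act k g w"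
  interpret \<phi>: group_action ?L ?E \<phi> by fact
  fix x show "\<phi> x = ?\<psi> x"
  proof (cases "x \<in> carrier ?L")
    case True
    have gh: "group_hom ?L (BijGroup ?E) \<phi>" "group_hom ?L (BijGroup ?E) ?\<psi>"
      using \<phi>(2) group_action_act[OF k] by (simp_all add: group_action_def)
    show ?thesis
    proof (rule hom_eq_on_generate[OF gh lamp_X_carrier[OF k]])
      fix y assume y: "y \<in> lamp_X k"
      then obtain r where r: "r < k" "y = lamp_cbar k r" by (auto simp: lamp_X_def)
      have yL: "y \<in> carrier ?L" using y lamp_X_carrier[OF k] by blast
      have "\<phi> y \<in> extensional ?E" by (rule Bij_imp_extensional[OF \<phi>.bij_prop0[OF yL]])
      then have "\<phi> y = (\<lambda>w\<in>?E. act k y w)"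
        by (rule extensionalityI[OF _ restrict_extensional])
          (use \<phi>(3) r k in \<open>simp add: act_lamp_cbar\<close>)
      then show "\<phi> y = ?\<psi> y" using yL by simp
    qed (use generate_lamp_X[OF k] True in auto)
  next
    case False
    then show ?thesis using extensional_arb[OF \<phi>(1) False] by (simp only: restrict_apply if_False)
  qed
qed

lemma ex1_lamp_action:
  assumes k: "k \<ge> 2"
  shows "\<exists>!\<phi>. \<phi> \<in> extensional (carrier (lamplighter k)) \<and>
     group_action (lamplighter k) (lists {..<k}) \<phi> \<and>
     (\<forall>r<k. \<forall>w\<in>lists {..<k}. \<phi> (lamp_cbar k r) w = word_step k r w)"
proof (rule ex1I)
  let ?\<psi> = "\<lambda>g\<in>carrier (lamplighter k). \<lambda>w\<in>lists {..<k}. act k g w"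
  have "?\<psi> (lamp_cbar k r) w = word_step k r w" if "r < k" "w \<in> lists {..<k}" for r w
  proof -
    have "lamp_cbar k r \<in> carrier (lamplighter k)"
      using lamp_X_carrier[OF k] that by (auto simp: lamp_X_def)
    then show ?thesis using that k act_lamp_cbar by simp
  qed
  then show "?\<psi> \<in> extensional (carrier (lamplighter k)) \<and>
     group_action (lamplighter k) (lists {..<k}) ?\<psi> \<and>
     (\<forall>r<k. \<forall>w\<in>lists {..<k}. ?\<psi> (lamp_cbar k r) w = word_step k r w)"
    using group_action_act[OF k] by blast
qed (use ex1_lamp_action_aux[OF k] in blast)

lemma lamp_action_eq:
  assumes "k \<ge> 2" "g \<in> carrier (lamplighter k)" "w \<in> lists {..<k}"
  shows "lamp_action k g w = act k g w"
  using theI'[OF ex1_lamp_action[OF assms(1)], folded lamp_action_def]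
    ex1_lamp_action_aux[OF assms(1), of "lamp_action k"] assms(2,3) by auto

end

(* A word w of length N is read as a polynomial modulo X^N, on which c^r b acts by
   w |-> (1 + X) w + r. A right coset W g is determined by the word g^-1 . 0^N and the exponent
   of g modulo M, and right multiplication of g by c^r b replaces w by (w - r) / (1 + X).
   The coordinates l_j(w) = [X^(N-1)] (1 + X)^(N-j) w, 1 <= j <= N, turn this into the spider-web
   move: for j < N, l_j of the new word is l_(j+1)(w - r) = l_(j+1)(w), since
   (1 + X)^(N-j-1) has degree below N - 1, and l_N of the new word runs bijectively
   through the residues modulo k as r does. *)

theory Submission
  imports Defs
begin

section \<open>Recognising Schreier graphs\<close>

lemma (in group) r_coset_eq_fibre:
  assumes H: "H \<subseteq> carrier G"
    and F: "\<And>g h. g \<in> carrier G \<Longrightarrow> h \<in> carrier G \<Longrightarrow> F g = F h \<longleftrightarrow> g \<otimes> inv h \<in> H"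
    and h: "h \<in> carrier G"
  shows "H #> h = {g \<in> carrier G. F g = F h}"
proof (intro equalityI subsetI)
  fix g assume "g \<in> H #> h"
  then obtain x where "x \<in> H" "g = x \<otimes> h" by (auto simp: r_coset_def)
  then show "g \<in> {g \<in> carrier G. F g = F h}"
    using H h by (auto simp: F subset_iff m_assoc)
next
  fix g assume g: "g \<in> {g \<in> carrier G. F g = F h}"
  then have "g \<otimes> inv h \<in> H" using F h by auto
  moreover have "g = (g \<otimes> inv h) \<otimes> h" using g h by (simp add: m_assoc)
  ultimately show "g \<in> H #> h" by (auto simp: r_coset_def)
qed

text \<open>Vertices correspond to cosets through the fibres of \<open>F\<close>. In
  \<open>step\<close> the bijection may vary with \<open>g\<close>: labels are ignored, so the edges
  leaving each vertex can be matched independently.\<close>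

lemma (in group) digraph_iso_schreier_graphI:
  assumes H: "H \<subseteq> carrier G" and S: "S \<subseteq> carrier G"
    and V: "F ` carrier G = V"
    and F: "\<And>g h. g \<in> carrier G \<Longrightarrow> h \<in> carrier G \<Longrightarrow> F g = F h \<longleftrightarrow> g \<otimes> inv h \<in> H"
    and step: "\<And>g. g \<in> carrier G \<Longrightarrow>
      \<exists>\<sigma>. bij_betw \<sigma> A S \<and> (\<forall>y\<in>A. trg (F g, y) = F (g \<otimes> \<sigma> y))"
  shows "digraph_iso \<lparr>verts = V, arcs = V \<times> A, tail = fst, head = trg\<rparr> (schreier_graph G H S)"
proof -
  let ?D = "\<lparr>verts = V, arcs = V \<times> A, tail = fst, head = trg\<rparr>"
  \<comment> \<open>Elements of one fibre may come with different bijections, so each vertex borrows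
    that of one chosen preimage.\<close>
  define rep where "rep v = inv_into (carrier G) F v" for v
  have rep: "rep v \<in> carrier G" "F (rep v) = v" if "v \<in> V" for v
    using that V by (auto simp: rep_def inv_into_into f_inv_into_f)
  obtain \<sigma>' where \<sigma>': "\<And>g. g \<in> carrier G \<Longrightarrow>
      bij_betw (\<sigma>' g) A S \<and> (\<forall>y\<in>A. trg (F g, y) = F (g \<otimes> \<sigma>' g y))"
    using step by metis
  define \<sigma> where "\<sigma> v = \<sigma>' (rep v)" for v
  have bij: "bij_betw (\<sigma> v) A S" if "v \<in> V" for v
    using \<sigma>'[OF rep(1)[OF that]] by (simp add: \<sigma>_def)
  have \<sigma>_carrier: "\<sigma> v y \<in> carrier G" if "v \<in> V" "y \<in> A" for v y
    using bij[OF that(1)] that(2) S by (auto simp: bij_betw_def)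
  have trg: "trg (v, y) = F (rep v \<otimes> \<sigma> v y)" if "v \<in> V" "y \<in> A" for v y
    using \<sigma>'[OF rep(1)[OF that(1)]] that rep(2)[OF that(1)] by (simp add: \<sigma>_def)
  have trg_V: "trg (v, y) \<in> V" if "v \<in> V" "y \<in> A" for v y
    using trg[OF that] V rep(1)[OF that(1)] \<sigma>_carrier[OF that] by auto
  define C where "C v = {g \<in> carrier G. F g = v}" for v
  have C: "C (F g) = H #> g" if "g \<in> carrier G" for g
    using r_coset_eq_fibre[OF H F that] by (simp add: C_def)
  have C_trg: "C (trg (v, y)) = C v #> \<sigma> v y" if "v \<in> V" "y \<in> A" for v y
  proof -
    have "C (trg (v, y)) = H #> (rep v \<otimes> \<sigma> v y)"
      using trg[OF that] C rep(1)[OF that(1)] \<sigma>_carrier[OF that] by simp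
    also have "\<dots> = C v #> \<sigma> v y"
      using C[OF rep(1)[OF that(1)]] rep[OF that(1)] \<sigma>_carrier[OF that] H
      by (simp add: coset_mult_assoc)
    finally show ?thesis .
  qed
  have C_image: "C ` V = rcosets H"
    using C V by (auto simp: RCOSETS_def)
  have C_inj: "inj_on C V"
    by (rule inj_onI) (metis (mono_tags, lifting) C_def mem_Collect_eq rep)
  let ?\<alpha> = "\<lambda>(v, y). (C v, \<sigma> v y)"
  have "?\<alpha> ` (V \<times> A) = (\<Union>v\<in>V. {C v} \<times> \<sigma> v ` A)" by force
  also have "\<dots> = (\<Union>v\<in>V. {C v} \<times> S)"
    using bij by (auto simp: bij_betw_def)
  also have "\<dots> = (rcosets H) \<times> S" using C_image by blast
  finally have \<alpha>_image: "?\<alpha> ` (V \<times> A) = (rcosets H) \<times> S" .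
  have \<alpha>_inj: "inj_on ?\<alpha> (V \<times> A)"
    using C_inj bij by (auto simp: inj_on_def bij_betw_def)
  \<comment> \<open>The fields \<open>iso_head\<close> and \<open>iso_tail\<close> are the endpoint
    maps of the image graph; taking those of \<open>schreier_graph\<close> makes the image literally
    equal to it.\<close>
  define iso where "iso = \<lparr>iso_verts = C, iso_arcs = ?\<alpha>,
    iso_head = (\<lambda>(D, s). D #> s), iso_tail = fst\<rparr>"
  have "pre_digraph.digraph_isomorphism ?D iso"
    using C_inj \<alpha>_inj C_trg trg_V
    by (auto simp: pre_digraph.digraph_isomorphism_def iso_def wf_digraph_def)
  moreover have "schreier_graph G H S = app_iso iso ?D"
    using C_image \<alpha>_image by (simp add: schreier_graph_def app_iso_def iso_def)
  ultimately show ?thesis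
    unfolding digraph_iso_def by blast
qed

section \<open>Residues modulo \<open>M\<close>\<close>

text \<open>The projection of the integers onto the representatives that \<open>cyclic_group\<close>
  uses for \<open>\<int>/M\<int>\<close>.\<close>

definition residue :: "enat \<Rightarrow> int \<Rightarrow> int" where
  "residue M a = (case M of enat m \<Rightarrow> a mod int m | \<infinity> \<Rightarrow> a)"

lemma range_residue:
  assumes "M \<ge> 1"
  shows "range (residue M) = carrier (cyclic_group M)"
proof (cases M)
  case (enat m)
  then have m: "m > 0" using assms by (auto simp: one_enat_def)
  have "a \<in> range (\<lambda>a. a mod int m)" if "0 \<le> a" "a < int m" for a
    using that by (intro range_eqI[of _ _ a]) simp
  then show ?thesis
    using m by (auto simp: enat residue_def cyclic_group_def carrier_integer_mod_group)
qed (simp add: residue_def cyclic_group_def)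

text \<open>For \<open>M = 1\<close> the integer \<open>1\<close> lies outside the carrier, but the
  group operation reduces the sum, so this case needs no exception.\<close>

lemma residue_add_1: "residue M a \<otimes>\<^bsub>cyclic_group M\<^esub> 1 = residue M (a + 1)"
  by (auto simp: residue_def cyclic_group_def mod_add_left_eq split: enat.split)

lemma residue_eq_iff: "residue M a = residue M b \<longleftrightarrow> zero_mod M (a - b)"
  by (auto simp: residue_def zero_mod_def cong_def mod_eq_dvd_iff dvd_eq_mod_eq_0
      split: enat.split)

section \<open>Spider-web coordinates of a word\<close>

text \<open>Counting from zero, entry \<open>j\<close> is the coordinate \<open>l_(j+1)\<close>: the
  exponents descend from \<open>N - 1\<close> to \<open>0\<close>, and the final entry is the last
  letter of \<open>w\<close> modulo \<open>k\<close>.\<close>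

definition spider_word :: "nat \<Rightarrow> nat list \<Rightarrow> nat list" where
  "spider_word k w = map (\<lambda>j. nat (fps_nth (xpow (int (length w - 1 - j)) * word_series w)
     (length w - 1) mod int k)) [0..<length w]"

lemma length_spider_word [simp]: "length (spider_word k w) = length w"
  by (simp add: spider_word_def)

lemma spider_word_in_lists: "k > 0 \<Longrightarrow> spider_word k w \<in> lists {..<k}"
  by (auto simp: spider_word_def nat_less_iff)

lemma word_series_replicate_0 [simp]: "word_series (replicate N 0) = 0"
  by (simp add: word_series_def fps_eq_iff)

lemma spider_word_replicate_0 [simp]: "spider_word k (replicate N 0) = replicate N 0"
  by (rule nth_equalityI) (auto simp: spider_word_def)

lemma series_congD:
  "series_cong k N s t \<Longrightarrow> i < N \<Longrightarrow> [fps_nth s i = fps_nth t i] (mod int k)"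
  by (simp add: series_cong_def)

text \<open>For a nonnegative exponent the series is a polynomial of degree \<open>m\<close>. This
  hides the constant \<open>r\<close> from all coordinates but the last.\<close>

lemma xpow_nth_eq_0: "m < n \<Longrightarrow> fps_nth (xpow (int m)) n = 0"
proof -
  have "fps_nth ((1 + fps_X) ^ m :: int fps) n = 0" if "m < n" for m n
    using that
  proof (induction m arbitrary: n)
    case (Suc m)
    then show ?case by (cases n) (auto simp: distrib_right)
  qed simp
  then show "m < n \<Longrightarrow> fps_nth (xpow (int m)) n = 0"
    by (simp add: xpow_def)
qed

lemma xpow_minus_1_nth: "fps_nth (xpow (- 1)) n = (- 1) ^ n"
  by (simp add: xpow_def)

(* The second summand of the last letter is - (-1)^(N-1) r; it is written without the truncated
   exponent. *)
lemma spider_word_step: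
  fixes w v :: "nat list"
  assumes k: "k > 0" and len: "length w = N" "length v = N" "N > 0"
    and wv: "series_cong k N (word_series w) (xpow 1 * word_series v + fps_const r)"
  shows "spider_word k v = tl (spider_word k w @ [nat
    ((fps_nth (xpow (- 1) * word_series w) (N - 1) + (- 1) ^ N * r) mod int k)])"
    (is "_ = tl (_ @ [?y])")
proof (rule nth_equalityI)
  show "length (spider_word k v) = length (tl (spider_word k w @ [?y]))"
    by (simp add: len)
next
  fix j assume "j < length (spider_word k v)"
  then have j: "j < N" by (simp add: len)
  show "spider_word k v ! j = tl (spider_word k w @ [?y]) ! j"
  proof (cases "Suc j < N")
    case True
    \<comment> \<open>Entry \<open>Suc j\<close> for \<open>w\<close> has exponent \<open>m\<close>
      and entry \<open>j\<close> for \<open>v\<close> has exponent \<open>m + 1\<close>; the extra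
      factor is the \<open>1 + X\<close> in \<open>wv\<close>.\<close>
    define m where "m = N - 1 - Suc j"
    have m: "int (N - 1 - j) = int m + 1" "m < N - 1" using True by (auto simp: m_def)
    have "series_cong k N (xpow (int m) * word_series w)
        (xpow (int m) * (xpow 1 * word_series v + fps_const r))"
      by (rule series_cong_mult[OF wv])
    also have "xpow (int m) * (xpow 1 * word_series v + fps_const r) =
        xpow (int m + 1) * word_series v + xpow (int m) * fps_const r"
      by (simp only: xpow_add distrib_left mult.assoc)
    finally have "[fps_nth (xpow (int m) * word_series w) (N - 1) =
        fps_nth (xpow (int m + 1) * word_series v) (N - 1)] (mod int k)"
      using xpow_nth_eq_0[OF m(2)] len(3)
      by (auto dest!: series_congD[of _ _ _ _ "N - 1"])
    moreover have "spider_word k v ! j =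
        nat (fps_nth (xpow (int m + 1) * word_series v) (N - 1) mod int k)"
      using j len m(1) by (simp add: spider_word_def del: of_nat_diff)
    moreover have "spider_word k w ! Suc j =
        nat (fps_nth (xpow (int m) * word_series w) (N - 1) mod int k)"
      using True len by (simp add: spider_word_def m_def del: of_nat_diff)
    ultimately have "spider_word k v ! j = spider_word k w ! Suc j"
      by (simp add: cong_def)
    then show ?thesis using True len by (simp add: nth_tl nth_append)
  next
    case False
    then have j: "j = N - 1" using j by simp
    \<comment> \<open>The last coordinate of \<open>v\<close> is its last letter, so
      \<open>wv\<close> is solved for \<open>v\<close> with the inverse of
      \<open>1 + X\<close>.\<close>
    have "series_cong k N (xpow (- 1) * word_series w)
        (xpow (- 1) * (xpow 1 * word_series v + fps_const r))"
      by (rule series_cong_mult[OF wv])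
    also have "xpow (- 1) * (xpow 1 * word_series v + fps_const r) =
        word_series v + xpow (- 1) * fps_const r"
      using xpow_add[of "- 1" 1] by (simp only: distrib_left mult.assoc[symmetric]) simp
    finally have "[fps_nth (xpow (- 1) * word_series w) (N - 1) =
        fps_nth (word_series v) (N - 1) + (- 1) ^ (N - 1) * r] (mod int k)"
      using len(3)
      by (auto dest!: series_congD[of _ _ _ _ "N - 1"] simp: xpow_minus_1_nth)
    \<comment> \<open>As \<open>N > 0\<close>, the coefficients \<open>(- 1) ^ N\<close> and
      \<open>(- 1) ^ (N - 1)\<close> are opposite and the multiples of \<open>r\<close>
      cancel.\<close>
    from cong_add[OF this cong_refl[of "(- 1) ^ N * r"]]
    have "[fps_nth (xpow (- 1) * word_series w) (N - 1) + (- 1) ^ N * r =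
        fps_nth (word_series v) (N - 1)] (mod int k)"
      using len(3) by (cases N) auto
    then have "?y = nat (fps_nth (word_series v) (N - 1) mod int k)"
      by (simp add: cong_def)
    then show ?thesis
      using j len by (simp add: spider_word_def nth_tl nth_append)
  qed
qed

section \<open>The map from the lamplighter group to the spider-web graph\<close>

text \<open>The action is on the left, so it is the inverse that makes the word constant on right
  cosets of the stabilizer. The component \<open>snd g\<close> is the total exponent.\<close>

definition spider_vertex :: "nat \<Rightarrow> nat \<Rightarrow> enat \<Rightarrow> (int \<Rightarrow> int) \<times> int \<Rightarrow> nat list \<times> int" where
  "spider_vertex k N M g =
    (spider_word k (act k (inv\<^bsub>lamplighter k\<^esub> g) (replicate N 0)), residue M (snd g))"

text \<open>A second multiplication by \<open>e\<close> undoes the first, which gives injectivity;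
  finiteness does the rest. It serves to solve for the generator that appends a given
  letter.\<close>

lemma bij_betw_sign_affine_mod:
  fixes k :: nat and a e :: int
  assumes k: "k > 0" and e: "e * e = 1"
  shows "bij_betw (\<lambda>y. nat (e * (int y - a) mod int k)) {..<k} {..<k}"
proof -
  let ?f = "\<lambda>y. nat (e * (int y - a) mod int k)"
  have inj: "inj_on ?f {..<k}"
  proof (rule inj_onI)
    fix x y assume xy: "x \<in> {..<k}" "y \<in> {..<k}" "?f x = ?f y"
    then have "[e * (int x - a) = e * (int y - a)] (mod int k)"
      using k by (simp add: cong_def nat_eq_iff)
    from cong_add[OF cong_mult[OF cong_refl[of e] this] cong_refl[of a]]
    have "[int x = int y] (mod int k)"
      by (simp add: mult.assoc[symmetric] e)
    then show "x = y" using xy by (simp add: cong_def)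
  qed
  moreover have "?f ` {..<k} \<subseteq> {..<k}" using k by (auto simp: nat_less_iff)
  ultimately show ?thesis
    by (simp add: bij_betw_def endo_inj_surj)
qed

lemma bij_betw_lamp_cbar: "k \<ge> 2 \<Longrightarrow> bij_betw (lamp_cbar k) {..<k} (lamp_X k)"
  by (auto simp: bij_betw_def lamp_X_def inj_on_def lamp_cbar_eq fun_eq_iff)

lemma lamp_cbar_carrier: "k \<ge> 2 \<Longrightarrow> r < k \<Longrightarrow> lamp_cbar k r \<in> carrier (lamplighter k)"
  using lamp_X_carrier by (auto simp: lamp_X_def)

lemma snd_mult_lamplighter: "snd (g \<otimes>\<^bsub>lamplighter k\<^esub> h) = snd g + snd h"
  by (cases g; cases h) (simp add: mult_lamplighter)

lemma snd_inv_lamplighter: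
  assumes "k > 0" "g \<in> carrier (lamplighter k)"
  shows "snd (inv\<^bsub>lamplighter k\<^esub> g) = - snd g"
proof -
  interpret group "lamplighter k" by (rule group_lamplighter[OF assms(1)])
  show ?thesis
    using snd_mult_lamplighter[of k g "inv\<^bsub>lamplighter k\<^esub> g"] assms(2)
    by (simp add: one_lamplighter)
qed

text \<open>Only a congruence of the first coefficients can hold, because the action reduces letters
  modulo \<open>k\<close> and cuts the product off at the length of the word.\<close>

lemma series_cong_act_lamp_cbar:
  assumes "k \<ge> 2" "r < k"
  shows "series_cong k (length v) (word_series (act k (lamp_cbar k r) v))
    (xpow 1 * word_series v + fps_const (int r))"
proof -
  have "lamp_series (\<lambda>i. if i = 0 then int r else 0) = fps_const (int r)"
    by (subst lamp_series_superset[of "{0}"]) auto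
  moreover have "lamp_cbar k r = ((\<lambda>i. if i = 0 then int r else 0), 1)"
    using assms by (auto simp: lamp_cbar_eq fun_eq_iff)
  ultimately show ?thesis
    using assms word_series_series_word[of k "length v"] by (simp add: act_def del: xpow_1)
qed

text \<open>The generator that appends \<open>y\<close> is found by solving the formula for the last
  letter. The solution depends on the current word, so labels are not preserved.\<close>

lemma spider_vertex_step:
  assumes k: "k \<ge> 2" and g: "g \<in> carrier (lamplighter k)"
  obtains \<sigma> where "bij_betw \<sigma> {..<k} (lamp_X k)"
    and "\<And>y. y < k \<Longrightarrow> spider_vertex k N M (g \<otimes>\<^bsub>lamplighter k\<^esub> \<sigma> y) =
      (tl (fst (spider_vertex k N M g) @ [y]), snd (spider_vertex k N M g) \<otimes>\<^bsub>cyclic_group M\<^esub> 1)"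
proof
  let ?L = "lamplighter k" and ?o = "replicate N (0::nat)"
  have k0: "k > 0" using k by simp
  interpret group ?L by (rule group_lamplighter[OF k0])
  define w where "w = act k (inv\<^bsub>?L\<^esub> g) ?o"
  \<comment> \<open>For \<open>N > 0\<close> the generator with index \<open>r\<close> appends
    \<open>a + (- 1) ^ N * r\<close> modulo \<open>k\<close>; \<open>\<rho> y\<close> is the index
    for which this is \<open>y\<close>.\<close>
  define a where "a = fps_nth (xpow (- 1) * word_series w) (N - 1)"
  define \<rho> where "\<rho> y = nat ((- 1) ^ N * (int y - a) mod int k)" for y
  have sq: "(- 1) ^ N * (- 1) ^ N = (1::int)"
    by (simp add: power_mult_distrib[symmetric])
  have bij: "bij_betw \<rho> {..<k} {..<k}"
    unfolding \<rho>_def by (rule bij_betw_sign_affine_mod[OF k0 sq])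
  show "bij_betw (lamp_cbar k \<circ> \<rho>) {..<k} (lamp_X k)"
    by (rule bij_betw_trans[OF bij bij_betw_lamp_cbar[OF k]])
  fix y assume y: "y < k"
  have r: "\<rho> y < k" using bij y by (auto simp: bij_betw_def)
  let ?c = "lamp_cbar k (\<rho> y)"
  have c: "?c \<in> carrier ?L" by (rule lamp_cbar_carrier[OF k r])
  define v where "v = act k (inv\<^bsub>?L\<^esub> (g \<otimes>\<^bsub>?L\<^esub> ?c)) ?o"
  have len: "length w = N" "length v = N" by (simp_all add: w_def v_def)
  \<comment> \<open>Since \<open>c (g c)^-1 = g^-1\<close>, the generator carries the new word
    \<open>v\<close> back to the old word \<open>w\<close>.\<close>
  have "act k ?c v = act k (?c \<otimes>\<^bsub>?L\<^esub> inv\<^bsub>?L\<^esub> (g \<otimes>\<^bsub>?L\<^esub> ?c)) ?o"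
    unfolding v_def using g c by (simp add: act_mult[OF k0])
  also have "?c \<otimes>\<^bsub>?L\<^esub> inv\<^bsub>?L\<^esub> (g \<otimes>\<^bsub>?L\<^esub> ?c) = inv\<^bsub>?L\<^esub> g"
    using g c by (simp add: inv_mult_group m_assoc[symmetric])
  finally have wv: "series_cong k N (word_series w)
      (xpow 1 * word_series v + fps_const (int (\<rho> y)))"
    using series_cong_act_lamp_cbar[OF k r, of v] by (simp add: w_def[symmetric] len)
  have "spider_word k v = tl (spider_word k w @ [y])"
  proof (cases "N = 0")
    \<comment> \<open>Without letters both sides are empty, because \<open>tl [y]\<close>
      is.\<close>
    case True
    then show ?thesis using len by (simp add: spider_word_def)
  next
    case False
    have "[a + (- 1) ^ N * int (\<rho> y) = a + (- 1) ^ N * ((- 1) ^ N * (int y - a))] (mod int k)"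
      using k0 by (intro cong_add cong_mult) (auto simp: \<rho>_def cong_def)
    then have "(a + (- 1) ^ N * int (\<rho> y)) mod int k = int y"
      using y by (simp add: mult.assoc[symmetric] sq cong_def)
    then show ?thesis
      using spider_word_step[OF k0 len _ wv] False by (simp add: a_def)
  qed
  moreover have "snd ?c = 1" by (simp add: lamp_cbar_eq[OF k])
  ultimately show "spider_vertex k N M (g \<otimes>\<^bsub>?L\<^esub> (lamp_cbar k \<circ> \<rho>) y) =
      (tl (fst (spider_vertex k N M g) @ [y]), snd (spider_vertex k N M g) \<otimes>\<^bsub>cyclic_group M\<^esub> 1)"
    by (simp add: spider_vertex_def v_def w_def snd_mult_lamplighter residue_add_1)
qed

section \<open>Surjectivity onto the spider-web vertices\<close>

text \<open>The letters of \<open>ys\<close> are fed one by one into \<open>0^N\<close>. The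
  exponent \<open>n\<close> stays general because every edge raises it by one.\<close>

lemma spider_word_reachable:
  assumes k: "k \<ge> 2" and "ys \<in> lists {..<k}"
  shows "\<exists>g\<in>carrier (lamplighter k). spider_vertex k N M g =
    (drop (length ys) (replicate N 0 @ ys), residue M n)"
  using assms(2)
proof (induction ys arbitrary: n rule: rev_induct)
  case Nil
  let ?L = "lamplighter k"
  interpret group ?L using k by (intro group_lamplighter) auto
  \<comment> \<open>The power \<open>b^n\<close> fixes \<open>0^N\<close>, so the walk can start at
    any level.\<close>
  let ?g = "((\<lambda>_. 0), n) :: (int \<Rightarrow> int) \<times> int"
  have g: "?g \<in> carrier ?L" by (auto simp: carrier_lamplighter)
  have "inv\<^bsub>?L\<^esub> ?g = ((\<lambda>_. 0), - n)"
    by (rule inv_equality) (auto simp: mult_lamplighter one_lamplighter carrier_lamplighter)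
  then have "act k (inv\<^bsub>?L\<^esub> ?g) (replicate N 0) = replicate N 0"
    by (auto simp: act_def lamp_series_def series_word_def intro: nth_equalityI)
  then show ?case
    using g by (intro bexI[of _ ?g]) (simp_all add: spider_vertex_def)
next
  case (snoc y ys)
  interpret group "lamplighter k" using k by (intro group_lamplighter) auto
  obtain g where g: "g \<in> carrier (lamplighter k)"
    "spider_vertex k N M g = (drop (length ys) (replicate N 0 @ ys), residue M (n - 1))"
    using snoc.IH[of "n - 1"] snoc.prems by auto
  obtain \<sigma> where \<sigma>: "bij_betw \<sigma> {..<k} (lamp_X k)"
    "\<And>y. y < k \<Longrightarrow> spider_vertex k N M (g \<otimes>\<^bsub>lamplighter k\<^esub> \<sigma> y) =
      (tl (fst (spider_vertex k N M g) @ [y]), snd (spider_vertex k N M g) \<otimes>\<^bsub>cyclic_group M\<^esub> 1)"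
    using spider_vertex_step[OF k g(1)] by blast
  have y: "y < k" using snoc.prems by simp
  then have mem: "g \<otimes>\<^bsub>lamplighter k\<^esub> \<sigma> y \<in> carrier (lamplighter k)"
    using \<sigma>(1) g(1) lamp_X_carrier[OF k] by (auto simp: bij_betw_def)
  have tl: "tl (drop (length ys) (replicate N 0 @ ys) @ [y]) =
      drop (length (ys @ [y])) (replicate N 0 @ ys @ [y])"
  proof -
    have "drop (length ys) (replicate N 0 @ ys) @ [y] =
        drop (length ys) (replicate N 0 @ ys @ [y])" by simp
    then show ?thesis by (simp only: length_append_singleton drop_Suc tl_drop)
  qed
  have "spider_vertex k N M (g \<otimes>\<^bsub>lamplighter k\<^esub> \<sigma> y) =
      (drop (length (ys @ [y])) (replicate N 0 @ ys @ [y]), residue M n)"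
    using \<sigma>(2)[OF y] tl by (simp add: g(2) residue_add_1)
  then show ?case using mem by auto
qed

lemma spider_vertex_image:
  assumes k: "k \<ge> 2" and M: "M \<ge> 1"
  shows "spider_vertex k N M ` carrier (lamplighter k) =
    {xs. set xs \<subseteq> {..<k} \<and> length xs = N} \<times> carrier (cyclic_group M)" (is "?I = ?V")
proof
  show "?I \<subseteq> ?V"
    using spider_word_in_lists[of k] k range_residue[OF M]
    by (auto simp: spider_vertex_def in_lists_conv_set)
  show "?V \<subseteq> ?I"
  proof (rule subrelI)
    fix xs i assume "(xs, i) \<in> ?V"
    then have xs: "xs \<in> lists {..<k}" "length xs = N" and "i \<in> range (residue M)"
      using range_residue[OF M] by auto
    then obtain n where "i = residue M n" by blast
    \<comment> \<open>After \<open>N\<close> letters all initial zeros have been dropped.\<close>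
    then show "(xs, i) \<in> ?I"
      using spider_word_reachable[OF k xs(1), of N M n] xs(2) by (auto simp: image_iff) metis
  qed
qed

(* Reachability in the spider-web graph yields surjectivity, and counting does the rest, so that
   no triangular system of binomial coefficients has to be inverted. *)
lemma inj_on_spider_word:
  assumes k: "k \<ge> 2"
  shows "inj_on (spider_word k) {xs. set xs \<subseteq> {..<k} \<and> length xs = N}" (is "inj_on _ ?E")
proof (rule finite_surj_inj)
  show "finite ?E" by (simp add: finite_lists_length_eq)
  show "?E \<subseteq> spider_word k ` ?E"
  proof
    fix xs assume "xs \<in> ?E"
    \<comment> \<open>Only the word component matters here, so the choice of
      \<open>\<infinity>\<close> and of level \<open>0\<close> is arbitrary.\<close>
    then have "(xs, 0) \<in> spider_vertex k N \<infinity> ` carrier (lamplighter k)"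
      using spider_vertex_image[OF k, of \<infinity> N] by (simp add: cyclic_group_def)
    then obtain g where "xs = spider_word k (act k (inv\<^bsub>lamplighter k\<^esub> g) (replicate N 0))"
      by (auto simp: spider_vertex_def)
    moreover have "act k x (replicate N 0) \<in> ?E" for x
      using act_in_lists[of k x "replicate N 0"] k by auto
    ultimately show "xs \<in> spider_word k ` ?E" by blast
  qed
qed

section \<open>Fibres of the vertex map as cosets of \<open>lamp_W\<close>\<close>

lemma lamp_W_eq:
  assumes k: "k \<ge> 2"
  shows "lamp_W k N M = {g \<in> carrier (lamplighter k).
    act k g (replicate N 0) = replicate N 0 \<and> zero_mod M (snd g)}"
proof -
  have "lamp_action k g (replicate N 0) = act k g (replicate N 0)"
    if "g \<in> carrier (lamplighter k)" for g
    using k that by (intro lamp_action_eq) auto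
  then show ?thesis
    using k by (auto simp: lamp_W_def lamp_W1_def stabilizer_def lamp_exp_eq)
qed

text \<open>As \<open>spider_word\<close> is injective on words of length \<open>N\<close>, equal
  words mean that \<open>g h^-1\<close> fixes \<open>0^N\<close>; equal residues mean that its
  exponent vanishes modulo \<open>M\<close>.\<close>

lemma spider_vertex_eq_iff:
  assumes k: "k \<ge> 2" and g: "g \<in> carrier (lamplighter k)" and h: "h \<in> carrier (lamplighter k)"
  shows "spider_vertex k N M g = spider_vertex k N M h \<longleftrightarrow>
    g \<otimes>\<^bsub>lamplighter k\<^esub> inv\<^bsub>lamplighter k\<^esub> h \<in> lamp_W k N M"
proof -
  let ?L = "lamplighter k" and ?o = "replicate N (0::nat)"
  have k0: "k > 0" using k by simp
  interpret group ?L by (rule group_lamplighter[OF k0])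
  have o: "?o \<in> lists {..<k}" using k by auto
  have act_inv: "act k x (act k (inv\<^bsub>?L\<^esub> x) w) = w" "act k (inv\<^bsub>?L\<^esub> x) (act k x w) = w"
    if "x \<in> carrier ?L" "w \<in> lists {..<k}" for x w
    using that by (simp_all add: act_mult[OF k0, symmetric] act_one)
  have "act k x ?o \<in> {xs. set xs \<subseteq> {..<k} \<and> length xs = N}" for x
    using act_in_lists[OF k0, of x ?o] by auto
  then have "spider_word k (act k (inv\<^bsub>?L\<^esub> g) ?o) = spider_word k (act k (inv\<^bsub>?L\<^esub> h) ?o) \<longleftrightarrow>
      act k (inv\<^bsub>?L\<^esub> g) ?o = act k (inv\<^bsub>?L\<^esub> h) ?o"
    by (intro inj_on_eq_iff[OF inj_on_spider_word[OF k, of N]])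
  also have "\<dots> \<longleftrightarrow> act k g (act k (inv\<^bsub>?L\<^esub> h) ?o) = ?o"
    using act_inv[OF g o] act_inv(2)[OF g act_in_lists[OF k0]] by metis
  also have "\<dots> \<longleftrightarrow> act k (g \<otimes>\<^bsub>?L\<^esub> inv\<^bsub>?L\<^esub> h) ?o = ?o"
    using g h by (simp add: act_mult[OF k0])
  finally show ?thesis
    using g h by (simp add: spider_vertex_def lamp_W_eq[OF k] residue_eq_iff
        snd_mult_lamplighter snd_inv_lamplighter[OF k0])
qed

theorem theorem6p1:
  fixes k N :: nat and M :: enat
  assumes "k \<ge> 2" and "M \<ge> 1"
  shows "digraph_iso (spider_web k N M) (schreier_graph (lamplighter k) (lamp_W k N M) (lamp_X k))"
proof -
  interpret group "lamplighter k" using assms by (intro group_lamplighter) auto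
  show ?thesis
    unfolding spider_web_def Let_def
  proof (rule digraph_iso_schreier_graphI[OF _ lamp_X_carrier[OF assms(1)]
        spider_vertex_image[OF assms] spider_vertex_eq_iff[OF assms(1)]])
    show "lamp_W k N M \<subseteq> carrier (lamplighter k)"
      by (auto simp: lamp_W_eq[OF assms(1)])
  next
    fix g assume "g \<in> carrier (lamplighter k)"
    from spider_vertex_step[OF assms(1) this, of N M]
    show "\<exists>\<sigma>. bij_betw \<sigma> {..<k} (lamp_X k) \<and> (\<forall>y\<in>{..<k}.
      (\<lambda>((xs, i), y). (tl (xs @ [y]), i \<otimes>\<^bsub>cyclic_group M\<^esub> 1)) (spider_vertex k N M g, y) =
      spider_vertex k N M (g \<otimes>\<^bsub>lamplighter k\<^esub> \<sigma> y))"
      by (metis (mono_tags, lifting) case_prod_conv case_prod_unfold lessThan_iff)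
  qed
qed

end
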